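(* Let $\mathcal{F}$ be a (possibly infinite) pairwise intersecting family of cosets of closed subgroups of $\mathbb{S}^1$. Then $\mathcal{F}$ has non-empty intersection, that is, $\bigcap_{A\in\mathcal{F}}A\neq\emptyset$.
   Context: $\mathbb{S}^1=\{z\in\mathbb{C} : |z|=1\}$ is the circle group under multiplication, with its usual topology. Different members of $\mathcal{F}$ may be cosets of different closed subgroups. A family is pairwise intersecting if any two of its members have non-empty intersection. *)

theory Defs
  imports "HOL-Analysis.Analysis" "HOL-Algebra.Coset"
begin

definition circle_group :: "complex monoid" where
  "circle_group = \<lparr>carrier = sphere 0 1, mult = (*), one = 1\<rparr>"

lemma circle_group_comm_group: "comm_group circle_group"
proof (rule comm_groupI)
  fix x assume x: "x \<in> carrier circle_group"
  then have "cnj x \<in> carrier circle_group" "cnj x * x = 1"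
    by (auto simp: circle_group_def complex_norm_square [symmetric] mult.commute)
  then show "\<exists>y\<in>carrier circle_group. y \<otimes>\<^bsub>circle_group\<^esub> x = \<one>\<^bsub>circle_group\<^esub>"
    by (auto simp: circle_group_def)
qed (auto simp: circle_group_def norm_mult)

definition closed_subgroup :: "complex set \<Rightarrow> bool" where
  "closed_subgroup H \<longleftrightarrow>
     subgroup H circle_group \<and> closedin (top_of_set (carrier circle_group)) H"

(* The group is abelian, so right cosets and left cosets coincide. *)
definition closed_subgroup_coset :: "complex set \<Rightarrow> bool" where
  "closed_subgroup_coset A \<longleftrightarrow> (\<exists>H. closed_subgroup H \<and> A \<in> rcosets\<^bsub>circle_group\<^esub> H)"

end

(* A closed subgroup of the circle is the group of n-th roots of unity for some n, where n = 0
   stands for the whole circle: an infinite subgroup contains elements arbitrarily close to 1, and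
   their powers are dense.  Hence every coset has the form {z. z^n = g^n} on the circle.  If z is a
   product of a b-th and a c-th root of unity then, by Bezout, the factors can be chosen to be
   powers of z.  This yields the Helly property for three cosets, hence for finitely many, and
   compactness of the circle gives the general case. *)
theory Submission
  imports Defs
begin

section \<open>Closed subgroups of the circle\<close>

text \<open>A chord is at most as long as its arc; this later turns a bound on angles into a bound
  on distances.\<close>

lemma norm_cis_diff_le: "norm (cis s - cis t) \<le> \<bar>s - t\<bar>"
proof -
  have "cis s - cis t = cis t * (cis (s - t) - 1)"
    by (simp add: algebra_simps cis_mult)
  then have "norm (cis s - cis t) = norm (cis (s - t) - 1)"
    by (simp add: norm_mult)
  also have "\<dots> = 2 * \<bar>sin ((s - t) / 2)\<bar>"
    using dist_exp_i_1[of "s - t"] by (simp add: cis_conv_exp)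
  also have "\<dots> \<le> \<bar>s - t\<bar>"
    using abs_sin_x_le_abs_x[of "(s - t) / 2"] by simp
  finally show ?thesis .
qed

lemma infinite_bounded_close_points:
  fixes S :: "'a::heine_borel set"
  assumes "infinite S" "bounded S" "e > 0"
  obtains x y where "x \<in> S" "y \<in> S" "x \<noteq> y" "dist x y < e"
proof -
  have "compact (closure S)"
    using assms by (simp add: compact_closure)
  then obtain a where a: "a islimpt S"
    using assms Heine_Borel_imp_Bolzano_Weierstrass closure_subset by metis
  obtain x where x: "x \<in> S" "x \<noteq> a" "dist x a < e / 2"
    using a assms(3) unfolding islimpt_approachable by (meson half_gt_zero)
  \<comment> \<open>Being strictly nearer to \<open>a\<close> than \<open>x\<close> is what makes
    \<open>y\<close> differ from \<open>x\<close>.\<close>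
  obtain y where y: "y \<in> S" "dist y a < min (e / 2) (dist x a)"
    using a x(2) assms(3) unfolding islimpt_approachable
    by (metis half_gt_zero min_less_iff_conj zero_less_dist_iff)
  show thesis
  proof
    show "x \<in> S" "y \<in> S" "x \<noteq> y" using x y by auto
    show "dist x y < e"
      using x(3) y(2) dist_triangle_half_l[of x a e y] by (simp add: dist_commute)
  qed
qed

lemma power_int_closed:
  fixes z :: "'a::field"
  assumes "1 \<in> H" "\<And>x y. x \<in> H \<Longrightarrow> y \<in> H \<Longrightarrow> x * y \<in> H" "\<And>x. x \<in> H \<Longrightarrow> inverse x \<in> H"
    and "z \<in> H"
  shows "z powi i \<in> H"
proof -
  have "w ^ n \<in> H" if "w \<in> H" for w and n :: nat
    using that by (induction n) (auto intro: assms)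
  then show ?thesis
    by (simp add: power_int_def assms)
qed

text \<open>The quotient of two close elements of \<open>H\<close> is near 1 but not 1, so its
  integer powers go round the circle in small steps. Thus \<open>H\<close> is dense as well as
  closed.\<close>

lemma infinite_closed_circle_subgroup:
  fixes H :: "complex set"
  assumes sub: "H \<subseteq> sphere 0 1" and cl: "closed H" and inf: "infinite H"
    and one: "1 \<in> H"
    and mult: "\<And>x y. x \<in> H \<Longrightarrow> y \<in> H \<Longrightarrow> x * y \<in> H"
    and inv: "\<And>x. x \<in> H \<Longrightarrow> inverse x \<in> H"
  shows "H = sphere 0 1"
proof -
  have "w \<in> closure H" if w: "w \<in> sphere 0 1" for w
    unfolding closure_approachable
  proof (intro allI impI)
    fix e :: real assume e: "e > 0"
    have "isCont Arg 1"
      by (rule continuous_at_Arg) (auto simp: complex_nonpos_Reals_iff)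
    then obtain d where d: "d > 0" "\<And>z. dist z 1 < d \<Longrightarrow> \<bar>Arg z\<bar> < e"
      using e unfolding continuous_at_eps_delta by (force simp: dist_real_def)
    obtain x y where xy: "x \<in> H" "y \<in> H" "x \<noteq> y" "dist x y < d"
      using infinite_bounded_close_points[OF inf _ d(1)] sub bounded_subset bounded_sphere by metis
    define z where "z = x * inverse y"
    have ny: "norm y = 1" using xy sub by auto
    then have y0: "y \<noteq> 0" by auto
    have z: "z \<in> H" using xy mult inv by (simp add: z_def)
    then have nz: "norm z = 1" using sub by auto
    have "z - 1 = (x - y) * inverse y" using y0 by (simp add: z_def field_simps)
    then have "dist z 1 < d"
      using xy(4) ny by (simp add: dist_norm norm_mult norm_inverse)
    then have small: "\<bar>Arg z\<bar> < e" by (rule d)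
    have "z \<noteq> 1" using xy(3) y0 by (auto simp: z_def field_simps)
    have z_cis: "cis (Arg z) = z" and w_cis: "cis (Arg w) = w"
      using nz w rcis_cmod_Arg[of z] rcis_cmod_Arg[of w] by (auto simp: rcis_def)
    have "Arg z \<noteq> 0" using z_cis \<open>z \<noteq> 1\<close> by force
    \<comment> \<open>Rounding down brings the angle \<open>n * Arg z\<close> within one step
      \<open>Arg z\<close> of \<open>Arg w\<close>, whatever the sign of
      \<open>Arg z\<close>.\<close>
    define n where "n = \<lfloor>Arg w / Arg z\<rfloor>"
    have "Arg w - of_int n * Arg z = (Arg w / Arg z - of_int n) * Arg z"
      using \<open>Arg z \<noteq> 0\<close> by (simp add: field_simps)
    moreover have "\<bar>Arg w / Arg z - of_int n\<bar> \<le> 1"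
      unfolding n_def by linarith
    ultimately have "\<bar>of_int n * Arg z - Arg w\<bar> \<le> \<bar>Arg z\<bar>"
      by (metis abs_ge_zero abs_minus_commute abs_mult mult_left_le_one_le)
    then have "dist (z powi n) w < e"
      using norm_cis_diff_le[of "of_int n * Arg z" "Arg w"] small w_cis z_cis
        cis_power_int[of "Arg z" n] by (simp add: dist_norm)
    moreover have "z powi n \<in> H"
      by (rule power_int_closed[OF one mult inv z])
    ultimately show "\<exists>y\<in>H. dist y w < e" by blast
  qed
  then show ?thesis using sub cl by auto
qed

text \<open>Multiplication by \<open>z\<close> permutes \<open>H\<close>, so comparing the products
  of all elements gives \<open>z ^ card H = 1\<close>. This equation has exactly
  \<open>card H\<close> solutions, so the inclusion is an equality.\<close>

lemma finite_circle_subgroup: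
  fixes H :: "complex set"
  assumes sub: "H \<subseteq> sphere 0 1" and fin: "finite H" and "1 \<in> H"
    and mult: "\<And>x y. x \<in> H \<Longrightarrow> y \<in> H \<Longrightarrow> x * y \<in> H"
  shows "H = {z. z ^ card H = 1}"
proof -
  have pos: "card H > 0" using assms by (auto simp: card_gt_0_iff)
  have nz: "x \<noteq> 0" if "x \<in> H" for x using that sub by auto
  have "z ^ card H = 1" if z: "z \<in> H" for z
  proof -
    have inj: "inj_on ((*) z) H" using nz[OF z] by (auto simp: inj_on_def)
    have "(*) z ` H = H"
      using endo_inj_surj[OF fin _ inj] mult z by auto
    then have "\<Prod>H = (\<Prod>x\<in>H. z * x)"
      using prod.reindex[OF inj, of "\<lambda>x. x"] by simp
    also have "\<dots> = z ^ card H * \<Prod>H"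
      by (simp add: prod.distrib)
    finally show ?thesis using nz fin by auto
  qed
  then show ?thesis
    using pos finite_roots_unity[of "card H", where ?'a = complex] card_roots_unity_eq[OF pos]
    by (intro card_subset_eq) auto
qed

lemma inv_circle_group:
  assumes "x \<in> carrier circle_group"
  shows "inv\<^bsub>circle_group\<^esub> x = inverse x"
proof -
  interpret comm_group circle_group by (rule circle_group_comm_group)
  from assms have "x \<noteq> 0" "norm x = 1" by (auto simp: circle_group_def)
  then show ?thesis
    using assms by (intro inv_equality) (auto simp: circle_group_def norm_inverse)
qed

lemma closed_subgroup_roots_of_unity:
  assumes "closed_subgroup H"
  obtains n where "H = {z \<in> sphere 0 1. z ^ n = 1}"
proof -
  from assms have sg: "subgroup H circle_group"
    and "closedin (top_of_set (carrier circle_group)) H"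
    by (auto simp: closed_subgroup_def)
  then have cl: "closed H"
    by (auto simp: circle_group_def intro: closedin_closed_trans)
  have sub: "H \<subseteq> sphere 0 1" and one: "1 \<in> H"
    and mult: "\<And>x y. x \<in> H \<Longrightarrow> y \<in> H \<Longrightarrow> x * y \<in> H"
    using subgroup.subset[OF sg] subgroup.one_closed[OF sg] subgroup.m_closed[OF sg]
    by (auto simp: circle_group_def)
  have inv: "inverse x \<in> H" if "x \<in> H" for x
    using subgroup.m_inv_closed[OF sg that] inv_circle_group subgroup.subset[OF sg] that by auto
  show thesis
  proof (cases "finite H")
    case True
    then show ?thesis
      using finite_circle_subgroup[OF sub True one mult] sub by (intro that[of "card H"]) auto
  next
    case False
    then show ?thesis
      using infinite_closed_circle_subgroup[OF sub cl False one mult inv]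
      by (intro that[of 0]) auto
  qed
qed

section \<open>The Helly property\<close>

text \<open>Solution sets of one equation are easy to intersect, and exponent 0 covers the whole
  circle. Since \<open>g\<close> may lie off the circle, the set can be empty when
  \<open>n > 0\<close>.\<close>

definition root_coset :: "nat \<Rightarrow> complex \<Rightarrow> complex set" where
  "root_coset n g = {z \<in> sphere 0 1. z ^ n = g ^ n}"

lemma root_coset_subset: "root_coset n g \<subseteq> sphere 0 1"
  by (auto simp: root_coset_def)

lemma root_coset_0: "root_coset 0 g = sphere 0 1"
  by (auto simp: root_coset_def)

lemma closed_subgroup_coset_root_coset:
  assumes "closed_subgroup_coset A"
  obtains n g where "g \<in> A" "A = root_coset n g"
proof -
  obtain H g where H: "closed_subgroup H" and "g \<in> carrier circle_group"
    and "A = H #>\<^bsub>circle_group\<^esub> g"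
    using assms unfolding closed_subgroup_coset_def RCOSETS_def by blast
  then have g: "norm g = 1" and A: "A = (\<lambda>h. h * g) ` H"
    by (auto simp: r_coset_def circle_group_def)
  obtain n where n: "H = {z \<in> sphere 0 1. z ^ n = 1}"
    using closed_subgroup_roots_of_unity[OF H] .
  have g0: "g \<noteq> 0" using g by auto
  have "z \<in> A" if "z \<in> root_coset n g" for z
  proof -
    have "z = (z / g) * g" "z / g \<in> H"
      using that g g0 by (auto simp: n root_coset_def norm_divide power_divide)
    then show ?thesis unfolding A by blast
  qed
  moreover have "A \<subseteq> root_coset n g"
    using g by (auto simp: A n root_coset_def norm_mult power_mult_distrib)
  ultimately have "A = root_coset n g" by blast
  then show thesis using that[of g n] g by (auto simp: root_coset_def)
qed

lemma root_coset_cong: "x \<in> root_coset n g \<Longrightarrow> root_coset n g = root_coset n x"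
  by (auto simp: root_coset_def)

lemma power_gcd_eq_1:
  fixes z :: "'a::field"
  assumes "z \<noteq> 0" "z ^ m = 1" "z ^ n = 1"
  shows "z ^ gcd m n = 1"
proof -
  obtain u v where uv: "u * int m + v * int n = int (gcd m n)"
    using bezout_int[of "int m" "int n"] by auto
  have "z ^ gcd m n = z powi (int m * u + int n * v)"
    using uv by (simp add: mult.commute flip: power_int_of_nat)
  also have "\<dots> = 1"
    using assms by (simp add: power_int_add power_int_mult)
  finally show ?thesis .
qed

text \<open>Division by the common point \<open>x\<close> reduces the claim to roots of unity, where
  Bezout applies. The convention \<open>gcd n 0 = n\<close> fits exponent 0 for the circle.\<close>

lemma root_coset_Int:
  assumes "x \<in> root_coset m g" "x \<in> root_coset n h"
  shows "root_coset m g \<inter> root_coset n h = root_coset (gcd m n) x"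
proof -
  have nx: "norm x = 1" "x \<noteq> 0" using assms by (auto simp: root_coset_def)
  have "z ^ m = x ^ m \<and> z ^ n = x ^ n \<longleftrightarrow> z ^ gcd m n = x ^ gcd m n" if "norm z = 1" for z
  proof -
    have "z / x \<noteq> 0" using that nx by auto
    then have "(z / x) ^ m = 1 \<and> (z / x) ^ n = 1 \<longleftrightarrow> (z / x) ^ gcd m n = 1"
      using power_gcd_eq_1[of "z / x" m n] power_mult
      by (metis dvd_def gcd_dvd1 gcd_dvd2 power_one)
    then show ?thesis using nx by (simp add: power_divide)
  qed
  then show ?thesis
    unfolding root_coset_cong[OF assms(1)] root_coset_cong[OF assms(2)]
    by (auto simp: root_coset_def)
qed

text \<open>For nonzero \<open>b\<close> and \<open>c\<close>, write
  \<open>lcm b c = b * p = c * q\<close>. Then \<open>p\<close> and \<open>q\<close> are coprime,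
  and \<open>u * p + v * q = 1\<close> gives \<open>i = u * p\<close> and \<open>j = v * q\<close>.
  Since both factors are powers of \<open>z\<close>, they inherit any further equation
  \<open>z ^ a = 1\<close>.\<close>

lemma root_of_unity_split:
  fixes z :: "'a::field"
  assumes "z \<noteq> 0" "z ^ lcm b c = 1"
  obtains i j where "i + j = 1" "(z powi i) ^ b = 1" "(z powi j) ^ c = 1"
proof (cases "b = 0 \<or> c = 0")
  case True
  \<comment> \<open>A factor with exponent 0 is unconstrained, so it can take all of
    \<open>z\<close>.\<close>
  then show thesis using that[of 1 0] that[of 0 1] by auto
next
  case False
  define L where "L = lcm b c"
  obtain p q where p: "L = b * p" and q: "L = c * q"
    unfolding L_def by (meson dvd_def dvd_lcm1 dvd_lcm2)
  \<comment> \<open>Dividing \<open>L\<close> by \<open>gcd p q\<close> leaves a common multiple of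
    \<open>b\<close> and \<open>c\<close>, and \<open>L\<close> is the least positive one.\<close>
  have "gcd p q = 1"
  proof -
    have L0: "L > 0" using False by (simp add: L_def lcm_pos_nat)
    obtain r s where r: "p = gcd p q * r" and s: "q = gcd p q * s"
      by (meson dvd_def gcd_dvd1 gcd_dvd2)
    have g0: "gcd p q > 0" using L0 p by (auto intro: gr0I)
    have "gcd p q * (b * r) = L" "gcd p q * (c * s) = L"
      using p q r s by (metis mult.left_commute)+
    then have "b * r = c * s" "b * r > 0" and Lr: "gcd p q * (b * r) = L"
      using g0 L0 by (metis mult_left_cancel not_gr_zero, metis mult_0_right not_gr_zero, simp)
    then have "L dvd b * r" unfolding L_def by (metis dvd_triv_left lcm_least)
    then have "L \<le> b * r" using \<open>b * r > 0\<close> by (rule dvd_imp_le)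
    then have "gcd p q * (b * r) \<le> 1 * (b * r)" using Lr by simp
    then have "gcd p q \<le> 1" using \<open>b * r > 0\<close> by (simp only: mult_le_cancel2)
    then show ?thesis using g0 by linarith
  qed
  then obtain u v where uv: "u * int p + v * int q = 1"
    using bezout_int[of "int p" "int q"] by auto
  have *: "(z powi (u * int p)) ^ b = 1" if "L = b * p" for u b p
  proof -
    have "u * int p * int b = int L * u"
      using that by simp
    then have "(z powi (u * int p)) ^ b = z powi (int L * u)"
      by (metis power_int_mult power_int_of_nat)
    also have "\<dots> = 1" using assms by (simp add: L_def power_int_mult)
    finally show ?thesis .
  qed
  show thesis using that[OF uv * *] p q by blast
qed

text \<open>The quotient \<open>y / x\<close> is an \<open>a\<close>-th root of unity and, passing
  through \<open>w\<close>, a product of a \<open>b\<close>-th and a \<open>c\<close>-th one.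
  Splitting it into powers of itself allows \<open>x\<close> to be moved into the third coset
  without leaving the first two.\<close>

lemma root_coset_triple:
  assumes x: "x \<in> root_coset a g" "x \<in> root_coset b h"
    and y: "y \<in> root_coset a g" "y \<in> root_coset c k"
    and w: "w \<in> root_coset b h" "w \<in> root_coset c k"
  shows "root_coset a g \<inter> root_coset b h \<inter> root_coset c k \<noteq> {}"
proof -
  have norms: "norm x = 1" "norm y = 1" "norm w = 1"
    using assms by (auto simp: root_coset_def)
  then have nz: "x \<noteq> 0" "y \<noteq> 0" "w \<noteq> 0" by auto
  define z where "z = y / x"
  have z0: "z \<noteq> 0" and nz1: "norm z = 1"
    using nz norms by (auto simp: z_def norm_divide)
  have "y ^ a = x ^ a" "w ^ b = x ^ b" "y ^ c = w ^ c"
    using x y w by (auto simp: root_coset_def)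
  then have za: "z ^ a = 1" and "(w / x) ^ b = 1" "(y / w) ^ c = 1"
    using nz by (simp_all add: z_def power_divide)
  then have "(w / x) ^ lcm b c = 1" "(y / w) ^ lcm b c = 1"
    by (metis dvd_def dvd_lcm1 power_mult power_one, metis dvd_def dvd_lcm2 power_mult power_one)
  then have "((w / x) * (y / w)) ^ lcm b c = 1"
    by (simp only: power_mult_distrib mult_1)
  moreover have "(w / x) * (y / w) = z" using nz by (simp add: z_def)
  ultimately have "z ^ lcm b c = 1" by simp
  then obtain i j where ij: "i + j = 1" "(z powi i) ^ b = 1" "(z powi j) ^ c = 1"
    using root_of_unity_split[OF z0] by blast
  have ia: "(z powi i) ^ a = 1"
    using za by (metis mult.commute power_int_1_left power_int_mult power_int_of_nat)
  \<comment> \<open>The common point \<open>x * z powi i\<close> differs from \<open>y\<close> only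
    by a \<open>c\<close>-th root of unity, which puts it in the third coset.\<close>
  have "y = x * z powi i * z powi j"
    using ij(1) z0 nz by (simp add: mult.assoc z_def flip: power_int_add)
  then have "(x * z powi i) ^ c = y ^ c"
    using ij(3) by (simp add: power_mult_distrib)
  then have "x * z powi i \<in> root_coset a g \<inter> root_coset b h \<inter> root_coset c k"
    using x y ia ij(2) norms nz1
    by (auto simp: root_coset_def norm_mult norm_power_int power_mult_distrib)
  then show ?thesis by blast
qed

(* The second conjunct makes the induction go through: adding A to the family only needs the triple
   consisting of A, the new coset and the intersection of the remaining members. *)
lemma root_coset_finite_Helly:
  assumes "finite \<G>" "\<And>A. A \<in> \<G> \<Longrightarrow> \<exists>n g. A = root_coset n g"
    and "\<And>A B. A \<in> \<G> \<Longrightarrow> B \<in> \<G> \<Longrightarrow> A \<inter> B \<noteq> {}"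
  shows "(\<exists>n g. sphere 0 1 \<inter> \<Inter>\<G> = root_coset n g) \<and>
    (\<forall>n g. root_coset n g \<noteq> {} \<longrightarrow> (\<forall>A\<in>\<G>. root_coset n g \<inter> A \<noteq> {}) \<longrightarrow>
      root_coset n g \<inter> (sphere 0 1 \<inter> \<Inter>\<G>) \<noteq> {})"
  using assms
proof (induction \<G> rule: finite_induct)
  case empty
  show ?case
    using root_coset_0[symmetric] by (auto simp: Int_absorb2[OF root_coset_subset])
next
  case (insert A \<G>)
  obtain a g where A: "A = root_coset a g" using insert.prems(1) by blast
  define M where "M = sphere 0 1 \<inter> \<Inter>\<G>"
  have IH: "\<exists>n h. M = root_coset n h"
    "\<And>n g. root_coset n g \<noteq> {} \<Longrightarrow> (\<And>B. B \<in> \<G> \<Longrightarrow> root_coset n g \<inter> B \<noteq> {}) \<Longrightarrow>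
      root_coset n g \<inter> M \<noteq> {}"
    using insert.IH insert.prems unfolding M_def by auto
  obtain m h where M: "M = root_coset m h" using IH(1) by blast
  have M': "sphere 0 1 \<inter> \<Inter>(insert A \<G>) = A \<inter> M" by (auto simp: M_def)
  \<comment> \<open>The second conjunct of the induction hypothesis is applied with \<open>A\<close>
    itself as the extra coset.\<close>
  have AM: "A \<inter> M \<noteq> {}"
    unfolding A using insert.prems(2) by (intro IH(2)) (auto simp: A)
  then obtain x where "x \<in> A" "x \<in> M" by blast
  then have "A \<inter> M = root_coset (gcd a m) x"
    unfolding A M by (rule root_coset_Int)
  moreover have "root_coset n k \<inter> (A \<inter> M) \<noteq> {}"
    if "root_coset n k \<noteq> {}" "\<forall>B\<in>insert A \<G>. root_coset n k \<inter> B \<noteq> {}" for n k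
  proof -
    have "root_coset n k \<inter> M \<noteq> {}" using that by (intro IH(2)) auto
    moreover have "root_coset n k \<inter> A \<noteq> {}" using that by auto
    ultimately have "root_coset n k \<inter> A \<inter> M \<noteq> {}"
      using AM root_coset_triple[of _ n k a g _ m h] unfolding A M by blast
    then show ?thesis by blast
  qed
  ultimately show ?case unfolding M' by blast
qed

theorem theorem2:
  fixes \<F> :: "complex set set"
  assumes "\<And>A. A \<in> \<F> \<Longrightarrow> closed_subgroup_coset A"
    and "pairwise (\<lambda>A B. A \<inter> B \<noteq> {}) \<F>"
  shows "carrier circle_group \<inter> (\<Inter>A\<in>\<F>. A) \<noteq> {}"
proof -
  have root: "\<exists>n g. A = root_coset n g" and nonempty: "A \<noteq> {}" if "A \<in> \<F>" for A
    using closed_subgroup_coset_root_coset[OF assms(1)[OF that]] by blast+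
  \<comment> \<open>\<open>pairwise\<close> speaks only of distinct members; for
    \<open>A = B\<close> the nonemptiness of cosets takes over.\<close>
  have meet: "A \<inter> B \<noteq> {}" if "A \<in> \<F>" "B \<in> \<F>" for A B
    using assms(2) nonempty that by (cases "A = B") (auto simp: pairwise_def)
  have "sphere 0 1 \<inter> \<Inter>\<F> \<noteq> {}"
  proof (rule compact_imp_fip)
    show "closed A" if A: "A \<in> \<F>" for A
    proof -
      obtain n g where "A = root_coset n g" using root[OF A] by blast
      also have "\<dots> = sphere 0 1 \<inter> {z. z ^ n = g ^ n}"
        by (auto simp: root_coset_def)
      also have "closed \<dots>"
        by (intro closed_Int closed_sphere closed_Collect_eq continuous_intros)
      finally show ?thesis .
    qed
    show "sphere 0 1 \<inter> \<Inter>\<G> \<noteq> {}" if \<G>: "finite \<G>" "\<G> \<subseteq> \<F>" for \<G>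
    proof -
      have "sphere 0 1 \<inter> A \<noteq> {}" if A: "A \<in> \<G>" for A
      proof -
        obtain n g where "A = root_coset n g" using root[of A] \<G>(2) A by blast
        then have "A \<subseteq> sphere 0 1" using root_coset_subset by simp
        then show ?thesis using nonempty[of A] \<G>(2) A by blast
      qed
      \<comment> \<open>Taking the whole circle as the extra coset turns the second conjunct of the
        finite Helly lemma into the claim.\<close>
      then have "root_coset 0 1 \<noteq> {}" "\<forall>A\<in>\<G>. root_coset 0 1 \<inter> A \<noteq> {}"
        by (simp_all add: root_coset_0)
      moreover have "\<exists>n g. A = root_coset n g" if "A \<in> \<G>" for A
        using root that \<G>(2) by blast
      moreover have "A \<inter> B \<noteq> {}" if "A \<in> \<G>" "B \<in> \<G>" for A B
        using meet that \<G>(2) by blast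
      ultimately have "root_coset 0 1 \<inter> (sphere 0 1 \<inter> \<Inter>\<G>) \<noteq> {}"
        using root_coset_finite_Helly[OF \<G>(1)] by blast
      then show ?thesis by blast
    qed
  qed auto
  then show ?thesis by (simp add: circle_group_def)
qed

end
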